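(* Let $\ell > m > 0$ be integers, let $n \geq 1$ be an integer, and let $X_n, Y_n, Z_n$ be the auxiliary polynomials attached to $(\ell,m)$ (defined in the context). If $\mu \in \mathbb{C}$, then the triple $(x,y,z) = (\mu, \mu+m, \mu+\ell) \in \mathbb{C}^3$ satisfies $x^n + y^n = z^n$ if and only if $X_n(\mu) = Y_n(\mu+m) = Z_n(\mu+\ell) = 0$.
   Context: For integers $\ell > m > 0$ and $n\ge 1$, define monic polynomials in $\mathbb{Z}[t]$ by $$X_n(t) := t^n - \sum_{k=1}^{n} \binom{n}{k} t^{n-k} (\ell-m) Q_k(\ell,m),$$ $$Y_n(t) := t^n + \sum_{k=1}^{n} (-1)^k \binom{n}{k} t^{n-k}\, \ell\, Q_k(m, m-\ell),$$ $$Z_n(t) := t^n + \sum_{k=1}^{n} (-1)^k \binom{n}{k} t^{n-k} \left(\ell^k + (\ell-m)^k\right),$$ where, for integers $a \neq b$ and $k \ge 1$, $Q_k(a,b) := \frac{a^k - b^k}{a-b} = \sum_{i=0}^{k-1} a^{k-1-i} b^i$. *)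

theory Defs
  imports Complex_Main "HOL-Computational_Algebra.Polynomial"
begin

text \<open>For \<open>a \<noteq> b\<close> the integer division is exact; see \<open>Q_mult\<close> and \<open>Q_eq_sum\<close> below.\<close>

definition Q :: "nat \<Rightarrow> int \<Rightarrow> int \<Rightarrow> int" where
  "Q k a b = (a ^ k - b ^ k) div (a - b)"

lemma Q_eq_sum:
  assumes "a \<noteq> b"
  shows "Q k a b = (\<Sum>i<k. a ^ (k - 1 - i) * b ^ i)"
proof -
  have "a ^ k - b ^ k = (a - b) * (\<Sum>i<k. a ^ (k - 1 - i) * b ^ i)"
    using power_diff_sumr2[of b k a] by (simp add: algebra_simps)
  with assms show ?thesis by (simp add: Q_def)
qed

lemma Q_mult:
  assumes "a \<noteq> b"
  shows "(a - b) * Q k a b = a ^ k - b ^ k"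
proof -
  have "(a - b) dvd (a ^ k - b ^ k)" by (simp add: power_diff_sumr2)
  with assms show ?thesis by (simp add: Q_def)
qed

definition X_poly :: "int \<Rightarrow> int \<Rightarrow> nat \<Rightarrow> int poly" where
  "X_poly l m n =
    monom 1 n - (\<Sum>k=1..n. monom (of_nat (n choose k) * (l - m) * Q k l m) (n - k))"

definition Y_poly :: "int \<Rightarrow> int \<Rightarrow> nat \<Rightarrow> int poly" where
  "Y_poly l m n =
    monom 1 n + (\<Sum>k=1..n. monom ((- 1) ^ k * of_nat (n choose k) * l * Q k m (m - l)) (n - k))"

definition Z_poly :: "int \<Rightarrow> int \<Rightarrow> nat \<Rightarrow> int poly" where
  "Z_poly l m n =
    monom 1 n + (\<Sum>k=1..n. monom ((- 1) ^ k * of_nat (n choose k) * (l ^ k + (l - m) ^ k)) (n - k))"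

end

theory Submission
  imports Defs
begin

text \<open>
  Each polynomial regroups by the binomial theorem, for instance
  \<open>X\<^sub>n(t) = t\<^sup>n + (t + m)\<^sup>n - (t + \<ell>)\<^sup>n\<close>. Hence \<open>X\<^sub>n(\<mu>)\<close>, \<open>Y\<^sub>n(\<mu> + m)\<close> and
  \<open>Z\<^sub>n(\<mu> + \<ell>)\<close> are one and the same number \<open>\<mu>\<^sup>n + (\<mu> + m)\<^sup>n - (\<mu> + \<ell>)\<^sup>n\<close>.
\<close>

text \<open>Embedding the coefficients and then evaluating respects sums. With the variants below,
  this turns a sum of monomials over \<open>int\<close> into a sum in \<open>'a\<close>.\<close>

lemma poly_map_poly_of_int_add:
  fixes x :: "'a::comm_ring_1"
  shows "poly (map_poly of_int (p + q)) x = poly (map_poly of_int p) x + poly (map_poly of_int q) x"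
proof -
  have "map_poly of_int (p + q) = (map_poly of_int p + map_poly of_int q :: 'a poly)"
    by (rule poly_eqI) (simp add: coeff_map_poly)
  then show ?thesis by simp
qed

lemma poly_map_poly_of_int_diff:
  fixes x :: "'a::comm_ring_1"
  shows "poly (map_poly of_int (p - q)) x = poly (map_poly of_int p) x - poly (map_poly of_int q) x"
  using poly_map_poly_of_int_add[of "p - q" q x] by simp

lemma poly_map_poly_of_int_sum:
  fixes x :: "'a::comm_ring_1"
  shows "poly (map_poly of_int (sum f A)) x = (\<Sum>k\<in>A. poly (map_poly of_int (f k)) x)"
  by (induction A rule: infinite_finite_induct) (simp_all add: poly_map_poly_of_int_add)

lemma poly_map_poly_of_int_monom:
  fixes x :: "'a::comm_ring_1"
  shows "poly (map_poly of_int (monom c k)) x = of_int c * x ^ k"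
  by (simp add: map_poly_monom poly_monom)

lemmas poly_map_poly_of_int_simps =
  poly_map_poly_of_int_add poly_map_poly_of_int_diff
  poly_map_poly_of_int_sum poly_map_poly_of_int_monom

text \<open>The binomial theorem with its \<open>k = 0\<close> term \<open>t ^ n\<close> moved to
  the other side, since the sums in all three polynomials start at \<open>k = 1\<close>.\<close>

lemma binomial_tail:
  fixes t a :: "'a::comm_ring_1"
  shows "(\<Sum>k=1..n. of_nat (n choose k) * a ^ k * t ^ (n - k)) = (t + a) ^ n - t ^ n"
proof -
  have "(t + a) ^ n = (\<Sum>k\<le>n. of_nat (n choose k) * a ^ k * t ^ (n - k))"
    by (simp add: add.commute[of t a] binomial_ring)
  also have "{..n} = insert 0 {1..n}" by auto
  finally show ?thesis by simp
qed

text \<open>The factor \<open>l - m\<close> cancels the divisor in \<open>Q k l m\<close>, which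
  leaves the difference of the binomial tails for \<open>l\<close> and \<open>m\<close>.\<close>

lemma poly_X_poly:
  fixes t :: "'a::comm_ring_1"
  assumes "l \<noteq> m"
  shows "poly (map_poly of_int (X_poly l m n)) t = t ^ n + (t + of_int m) ^ n - (t + of_int l) ^ n"
proof -
  have coeff_eq: "of_nat (n choose k) * (l - m) * Q k l m = of_nat (n choose k) * (l ^ k - m ^ k)" for k
    using Q_mult[OF assms, of k] by (simp add: mult.assoc)
  have "poly (map_poly of_int (X_poly l m n)) t = t ^ n
      - ((\<Sum>k=1..n. of_nat (n choose k) * of_int l ^ k * t ^ (n - k))
       - (\<Sum>k=1..n. of_nat (n choose k) * of_int m ^ k * t ^ (n - k)))"
    unfolding X_poly_def coeff_eq
    \<comment> \<open>The two tails are merged into a single sum, to be matched term by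
      term.\<close>
    by (simp add: poly_map_poly_of_int_simps sum_subtractf[symmetric] left_diff_distrib
        right_diff_distrib mult.assoc)
  then show ?thesis unfolding binomial_tail by simp
qed

lemma poly_Y_poly:
  fixes t :: "'a::comm_ring_1"
  assumes "l \<noteq> 0"
  shows "poly (map_poly of_int (Y_poly l m n)) t =
    t ^ n + (t - of_int m) ^ n - (t - of_int m + of_int l) ^ n"
proof -
  have "(- 1) ^ k * of_nat (n choose k) * l * Q k m (m - l) =
      of_nat (n choose k) * ((- m) ^ k - (l - m) ^ k)" for k
  proof -
    have "(- 1) ^ k * of_nat (n choose k) * l * Q k m (m - l) =
        (- 1) ^ k * of_nat (n choose k) * (m ^ k - (m - l) ^ k)"
      \<comment> \<open>The factor \<open>l\<close> is the divisor \<open>m - (m - l)\<close> of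
        \<open>Q k m (m - l)\<close>.\<close>
      using Q_mult[of m "m - l" k] assms by (simp add: mult.assoc)
    \<comment> \<open>Absorbing the sign into the bases yields tails with \<open>a = - m\<close> and
      \<open>a = l - m\<close>.\<close>
    moreover have "(- m) ^ k = (- 1) ^ k * m ^ k" "(l - m) ^ k = (- 1) ^ k * (m - l) ^ k"
      by (simp_all flip: power_mult_distrib)
    ultimately show ?thesis by (simp add: algebra_simps)
  qed
  then have "poly (map_poly of_int (Y_poly l m n)) t = t ^ n
      + ((\<Sum>k=1..n. of_nat (n choose k) * (- of_int m) ^ k * t ^ (n - k))
       - (\<Sum>k=1..n. of_nat (n choose k) * (of_int l - of_int m) ^ k * t ^ (n - k)))"
    unfolding Y_poly_def
    by (simp add: poly_map_poly_of_int_simps sum_subtractf[symmetric] left_diff_distrib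
        right_diff_distrib mult.assoc)
  then show ?thesis unfolding binomial_tail by (simp add: algebra_simps)
qed

text \<open>Here two tails are added, each contributing \<open>- t ^ n\<close>; together with the
  leading \<open>t ^ n\<close> this leaves the single \<open>- t ^ n\<close>.\<close>

lemma poly_Z_poly:
  fixes t :: "'a::comm_ring_1"
  shows "poly (map_poly of_int (Z_poly l m n)) t =
    (t - of_int l) ^ n + (t - of_int l + of_int m) ^ n - t ^ n"
proof -
  have "(- 1) ^ k * of_nat (n choose k) * (l ^ k + (l - m) ^ k) =
      of_nat (n choose k) * ((- l) ^ k + (m - l) ^ k)" for k
  proof -
    have "(- l) ^ k = (- 1) ^ k * l ^ k" "(m - l) ^ k = (- 1) ^ k * (l - m) ^ k"
      by (simp_all flip: power_mult_distrib)
    then show ?thesis by (simp add: algebra_simps)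
  qed
  then have "poly (map_poly of_int (Z_poly l m n)) t = t ^ n
      + ((\<Sum>k=1..n. of_nat (n choose k) * (- of_int l) ^ k * t ^ (n - k))
       + (\<Sum>k=1..n. of_nat (n choose k) * (of_int m - of_int l) ^ k * t ^ (n - k)))"
    unfolding Z_poly_def
    by (simp add: poly_map_poly_of_int_simps sum.distrib[symmetric] distrib_left distrib_right
        mult.assoc)
  then show ?thesis unfolding binomial_tail by (simp add: algebra_simps)
qed

theorem proposition1:
  fixes l m :: int and n :: nat and \<mu> :: complex
  assumes "0 < m" and "m < l" and "1 \<le> n"
  shows "\<mu> ^ n + (\<mu> + of_int m) ^ n = (\<mu> + of_int l) ^ n \<longleftrightarrow>
    poly (map_poly of_int (X_poly l m n)) \<mu> = 0 \<and>
    poly (map_poly of_int (Y_poly l m n)) (\<mu> + of_int m) = 0 \<and>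
    poly (map_poly of_int (Z_poly l m n)) (\<mu> + of_int l) = 0"
proof -
  \<comment> \<open>The divisors \<open>l - m\<close> and \<open>l\<close> occurring in
    \<open>Q\<close> are nonzero.\<close>
  have "l \<noteq> m" "l \<noteq> 0" using assms by auto
  then show ?thesis by (simp add: poly_X_poly poly_Y_poly poly_Z_poly add.commute)
qed

end
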